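(* Let $G$ be a digraph and let $v\in V(G)$ be a vertex which is the target of exactly $k\geq 2$ edges $e_1,\dots,e_k$. Let $G_v^{k}$ be the graph obtained from $G$ by deleting the edges $e_1,\dots,e_k$ (keeping all vertices), and for $h=1,\dots,k$ let $G_v^{(h)}\coloneqq G_v^{k}\cup e_h$. Then there is an isomorphism of posets \[P(G)\cong \nabla_{P(G_v^{k})}\left(P(G_v^{(1)}),\dots,P(G_v^{(k)})\right),\] i.e. the path poset of $G$ is isomorphic to the iterated gluing of the path posets $P(G_v^{(1)}),\dots,P(G_v^{(k)})$ along their common subposet $P(G_v^{k})$.
   Context: A digraph $G=(V,E)$ consists of a finite set $V$ of vertices and a set of edges $E\subseteq (V\times V)\setminus\{(v,v)\mid v\in V\}$; for $e=(v,w)$, $s(e)=v$ is its source and $t(e)=w$ its target. A subgraph $H$ of $G$ is spanning if $V(H)=V(G)$. A simple path is a sequence of edges $e_1,\dots,e_n$ with $s(e_{i+1})=t(e_i)$, no vertex encountered twice, and $s(e_1)\neq t(e_n)$. A multipath of $G$ is a spanning subgraph each of whose connected components (connectedness of the underlying undirected graph) is either a single vertex or has edges which, in some order, form a simple path. The path poset $P(G)$ is the set of multipaths of $G$ partially ordered by the relation "is a subgraph of". If $G'$ is a spanning subgraph of $G$, then $P(G')$ is naturally a downward closed subposet of $P(G)$. Gluing of posets: if $P_1,\dots,P_k$ are posets each containing a common poset $Q$ as a subposet, the gluing $\nabla_Q(P_1,\dots,P_k)$ is the poset whose Hasse diagram is obtained from the Hasse diagrams of $P_1,\dots,P_k$ by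 identifying their copies of the Hasse diagram of $Q$ (its underlying set is the disjoint union of the $P_i$ with the copies of $Q$ identified). *)

theory Defs
  imports "Graph_Theory.Graph_Theory"
begin

section \<open>Path posets\<close>

text \<open>
  A finite simple digraph is a \<^typ>\<open>'a pair_pre_digraph\<close> satisfying the locale predicate
  \<^const>\<open>pair_digraph\<close> (finite, no loops, at most one arc from one vertex to another).
\<close>

text \<open>In an \<^const>\<open>pre_digraph.apath\<close> the list of all vertices met by the walk, both endpoints
  included, is distinct; hence the source of the first and the target of the last arc differ.\<close>

definition simple_path :: "('a, 'b) pre_digraph \<Rightarrow> 'b list \<Rightarrow> bool" where
  "simple_path G p \<longleftrightarrow> p \<noteq> [] \<and> (\<exists>u w. pre_digraph.apath G u p w)"

text \<open>\<^const>\<open>connected\<close> refers to the underlying undirected graph.\<close>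

definition connected_component :: "('a, 'b) pre_digraph \<Rightarrow> ('a, 'b) pre_digraph \<Rightarrow> bool" where
  "connected_component G C \<longleftrightarrow> pre_digraph.max_subgraph G connected C"

definition multipath :: "'a pair_pre_digraph \<Rightarrow> 'a pair_pre_digraph \<Rightarrow> bool" where
  "multipath G H \<longleftrightarrow>
     spanning (with_proj H) (with_proj G) \<and>
     (\<forall>C. connected_component (with_proj H) C \<longrightarrow>
        (\<exists>x. verts C = {x} \<and> arcs C = {}) \<or>
        (\<exists>p. simple_path C p \<and> set p = arcs C))"

text \<open>A poset is represented by its reflexive order relation, its underlying set being the
  \<^const>\<open>Field\<close> of that relation; so \<^const>\<open>iso\<close> is isomorphism of posets
  (see \<open>iso_iff2\<close>, which does not assume well-orders).\<close>

definition path_poset :: "'a pair_pre_digraph \<Rightarrow> 'a pair_pre_digraph rel" where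
  "path_poset G = {(H, H'). multipath G H \<and> multipath G H' \<and>
                            subgraph (with_proj H) (with_proj H')}"

lemma Field_path_poset: "Field (path_poset G) = {H. multipath G H}"
  by (auto simp: Field_def path_poset_def multipath_def spanning_def subgraph_def compatible_def)

lemma partial_order_on_path_poset: "partial_order_on {H. multipath G H} (path_poset G)"
  unfolding partial_order_on_def preorder_on_def
proof (intro conjI)
  show "path_poset G \<subseteq> {H. multipath G H} \<times> {H. multipath G H}"
    by (auto simp: path_poset_def)
  show "refl_on {H. multipath G H} (path_poset G)"
    by (auto simp: refl_on_def path_poset_def multipath_def spanning_def subgraph_def
        compatible_def)
  show "trans (path_poset G)"
    by (rule transI) (auto simp: path_poset_def subgraph_def compatible_def)
  show "antisym (path_poset G)"
    by (rule antisymI) (auto simp: path_poset_def subgraph_def intro!: pair_pre_digraph.equality)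
qed

definition del_edges :: "'a pair_pre_digraph \<Rightarrow> ('a \<times> 'a) set \<Rightarrow> 'a pair_pre_digraph" where
  "del_edges G A = G\<lparr>parcs := parcs G - A\<rparr>"

lemma multipath_spanning_subgraph:
  assumes "spanning (with_proj G') (with_proj G)"
  shows "multipath G' H \<longleftrightarrow> multipath G H \<and> parcs H \<subseteq> parcs G'"
proof -
  have "spanning (with_proj H) (with_proj G') \<longleftrightarrow>
        spanning (with_proj H) (with_proj G) \<and> parcs H \<subseteq> parcs G'"
    using assms by (auto simp: spanning_def subgraph_def compatible_def)
  then show ?thesis unfolding multipath_def by blast
qed

lemma path_poset_spanning_subgraph:
  assumes "spanning (with_proj G') (with_proj G)"
  shows "Restr (path_poset G) (Field (path_poset G')) = path_poset G'"
    and "(H, H') \<in> path_poset G \<Longrightarrow> H' \<in> Field (path_poset G') \<Longrightarrow> H \<in> Field (path_poset G')"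
  unfolding Field_path_poset
  by (auto simp: path_poset_def multipath_spanning_subgraph[OF assms] subgraph_def)

definition add_edge :: "'a pair_pre_digraph \<Rightarrow> 'a \<times> 'a \<Rightarrow> 'a pair_pre_digraph" where
  "add_edge G a = G\<lparr>pverts := insert (fst a) (insert (snd a) (pverts G)),
                    parcs := insert a (parcs G)\<rparr>"


section \<open>Gluing of posets\<close>

definition hasse :: "'b rel \<Rightarrow> 'b rel" where
  "hasse r = {(a, b) \<in> r. a \<noteq> b \<and> \<not> (\<exists>c. c \<noteq> a \<and> c \<noteq> b \<and> (a, c) \<in> r \<and> (c, b) \<in> r)}"

text \<open>The members of the family are made disjoint by tagging with the index; two tagged
  elements are identified iff they are equal or are copies of the same element of \<open>Q\<close>.
  In particular, elements common to several members of the family but not in \<open>Q\<close> stay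
  separate.\<close>

definition glue_disjoint_union :: "'i set \<Rightarrow> ('i \<Rightarrow> 'b rel) \<Rightarrow> ('i \<times> 'b) set" where
  "glue_disjoint_union I P = (SIGMA i:I. Field (P i))"

definition glue_equiv :: "'i set \<Rightarrow> ('i \<Rightarrow> 'b rel) \<Rightarrow> 'b rel \<Rightarrow> ('i \<times> 'b) rel" where
  "glue_equiv I P Q = {((i, x), (j, y)).
     (i, x) \<in> glue_disjoint_union I P \<and> (j, y) \<in> glue_disjoint_union I P \<and>
     x = y \<and> (i = j \<or> x \<in> Field Q)}"

definition glue_carrier :: "'i set \<Rightarrow> ('i \<Rightarrow> 'b rel) \<Rightarrow> 'b rel \<Rightarrow> ('i \<times> 'b) set set" where
  "glue_carrier I P Q = glue_disjoint_union I P // glue_equiv I P Q"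

definition glue_hasse :: "'i set \<Rightarrow> ('i \<Rightarrow> 'b rel) \<Rightarrow> 'b rel \<Rightarrow> ('i \<times> 'b) set rel" where
  "glue_hasse I P Q = {(glue_equiv I P Q `` {(i, a)}, glue_equiv I P Q `` {(i, b)}) | i a b.
     i \<in> I \<and> (a, b) \<in> hasse (P i)}"

text \<open>The order generated by the glued Hasse diagram. Intended for finite posets \<open>P i\<close>, each
  containing \<open>Q\<close> as a downward closed subposet; then the result is indeed a partial order on
  the glued set and \<open>glue_hasse I P Q\<close> is its Hasse diagram, as shown below.\<close>

definition poset_glue :: "'i set \<Rightarrow> ('i \<Rightarrow> 'b rel) \<Rightarrow> 'b rel \<Rightarrow> ('i \<times> 'b) set rel" where
  "poset_glue I P Q = Id_on (glue_carrier I P Q) \<union> (glue_hasse I P Q)\<^sup>+"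

lemma equiv_glue_equiv: "equiv (glue_disjoint_union I P) (glue_equiv I P Q)"
  by (rule equivI) (auto simp: glue_equiv_def refl_on_def sym_def trans_def)

lemma glue_class_eq_iff:
  assumes "i \<in> I" "j \<in> I" "a \<in> Field (P i)" "b \<in> Field (P j)"
  shows "glue_equiv I P Q `` {(i, a)} = glue_equiv I P Q `` {(j, b)} \<longleftrightarrow>
         a = b \<and> (i = j \<or> a \<in> Field Q)"
  using assms eq_equiv_class_iff[OF equiv_glue_equiv, of "(i, a)" I P "(j, b)" Q]
  by (auto simp: glue_disjoint_union_def glue_equiv_def)

context
  fixes I :: "'i set" and P :: "'i \<Rightarrow> 'b rel" and Q :: "'b rel"
  assumes po: "\<And>i. i \<in> I \<Longrightarrow> partial_order_on (Field (P i)) (P i)"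
    and sub: "\<And>i. i \<in> I \<Longrightarrow> Restr (P i) (Field Q) = Q"
    and down: "\<And>i a b. i \<in> I \<Longrightarrow> (a, b) \<in> P i \<Longrightarrow> b \<in> Field Q \<Longrightarrow> a \<in> Field Q"
begin

private abbreviation cl where "cl i a \<equiv> glue_equiv I P Q `` {(i, a)}"

private lemma tr: "i \<in> I \<Longrightarrow> (a, b) \<in> P i \<Longrightarrow> (b, c) \<in> P i \<Longrightarrow> (a, c) \<in> P i"
  using po unfolding partial_order_on_def preorder_on_def trans_def by blast

private lemma anti: "i \<in> I \<Longrightarrow> (a, b) \<in> P i \<Longrightarrow> (b, a) \<in> P i \<Longrightarrow> a = b"
  using po unfolding partial_order_on_def antisym_def by blast

private lemma transfer:
  assumes "i \<in> I" "j \<in> I" "(a, b) \<in> P i" "b' \<in> Field (P j)" "cl i b = cl j b'"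
  shows "b' = b \<and> (a, b) \<in> P j \<and> cl i a = cl j a"
proof (cases "i = j")
  case True
  then show ?thesis using assms glue_class_eq_iff[of i I j b P b' Q] by (auto simp: Field_def)
next
  case False
  have F: "a \<in> Field (P i)" "b \<in> Field (P i)" using assms by (auto simp: Field_def)
  then have b: "b' = b" "b \<in> Field Q"
    using assms False glue_class_eq_iff[of i I j b P b' Q] by auto
  then have a: "a \<in> Field Q" using down assms by blast
  then have "(a, b) \<in> Q" using sub[of i] assms b by auto
  then have ab: "(a, b) \<in> P j" using sub[of j] assms by auto
  then have "a \<in> Field (P j)" by (auto simp: Field_def)
  then show ?thesis using ab a b F assms glue_class_eq_iff[of i I j a P a Q] by auto
qed

private lemma step_iff:
  assumes "(X, Y) \<in> (glue_hasse I P Q)\<^sup>+"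
  shows "\<exists>i a b. i \<in> I \<and> (a, b) \<in> P i \<and> a \<noteq> b \<and> X = cl i a \<and> Y = cl i b"
  using assms
proof (induction rule: trancl_induct)
  case (base Y)
  then show ?case unfolding glue_hasse_def hasse_def by blast
next
  case (step Y Z)
  then obtain i a b where 1: "i \<in> I" "(a, b) \<in> P i" "a \<noteq> b" "X = cl i a" "Y = cl i b" by blast
  from step(2) obtain j b' c where 2: "j \<in> I" "(b', c) \<in> P j" "b' \<noteq> c" "Y = cl j b'" "Z = cl j c"
    unfolding glue_hasse_def hasse_def by blast
  have "b' = b \<and> (a, b) \<in> P j \<and> cl i a = cl j a"
    using transfer[of i j a b b'] 1 2 by (auto simp: Field_def)
  then show ?case using 1 2 tr[of j a b c] anti[of j a b] by blast
qed

private lemma no_cycle: "(X, X) \<notin> (glue_hasse I P Q)\<^sup>+"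
proof
  assume "(X, X) \<in> (glue_hasse I P Q)\<^sup>+"
  from step_iff[OF this] obtain i a b
    where "i \<in> I" "(a, b) \<in> P i" "a \<noteq> b" "cl i a = cl i b" by metis
  then show False using glue_class_eq_iff[of i I i a P b Q] by (auto simp: Field_def)
qed

lemma partial_order_on_poset_glue: "partial_order_on (glue_carrier I P Q) (poset_glue I P Q)"
proof -
  have *: "(glue_hasse I P Q)\<^sup>+ \<subseteq> glue_carrier I P Q \<times> glue_carrier I P Q"
  proof (clarify)
    fix X Y assume "(X, Y) \<in> (glue_hasse I P Q)\<^sup>+"
    from step_iff[OF this] show "X \<in> glue_carrier I P Q \<and> Y \<in> glue_carrier I P Q"
      by (auto simp: glue_carrier_def glue_disjoint_union_def Field_def intro!: quotientI)
  qed
  show ?thesis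
    unfolding partial_order_on_def preorder_on_def
  proof (intro conjI)
    show "poset_glue I P Q \<subseteq> glue_carrier I P Q \<times> glue_carrier I P Q"
      using * by (auto simp: poset_glue_def)
    show "refl_on (glue_carrier I P Q) (poset_glue I P Q)"
      by (auto simp: refl_on_def poset_glue_def)
    show "trans (poset_glue I P Q)"
      unfolding poset_glue_def by (rule transI) (elim UnE Id_onE; force dest: trancl_trans)
    show "antisym (poset_glue I P Q)"
      by (rule antisymI) (use no_cycle in \<open>auto simp: poset_glue_def dest: trancl_trans\<close>)
  qed
qed

lemma hasse_poset_glue: "hasse (poset_glue I P Q) = glue_hasse I P Q"
proof (intro equalityI subrelI)
  fix X Y assume XY: "(X, Y) \<in> hasse (poset_glue I P Q)"
  then have "(X, Y) \<in> (glue_hasse I P Q)\<^sup>+" by (auto simp: hasse_def poset_glue_def)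
  then consider "(X, Y) \<in> glue_hasse I P Q"
    | Z where "(X, Z) \<in> glue_hasse I P Q" "(Z, Y) \<in> (glue_hasse I P Q)\<^sup>+"
    by (meson converse_tranclE)
  then show "(X, Y) \<in> glue_hasse I P Q"
  proof cases
    case 2
    then have "Z \<noteq> X" "Z \<noteq> Y" using no_cycle by (auto dest: r_into_trancl)
    then show ?thesis using 2 XY by (auto simp: hasse_def poset_glue_def)
  qed
next
  fix X Y assume XY: "(X, Y) \<in> glue_hasse I P Q"
  then obtain i a b where 1: "i \<in> I" "(a, b) \<in> hasse (P i)" "X = cl i a" "Y = cl i b"
    unfolding glue_hasse_def by blast
  have False if "(X, Z) \<in> (glue_hasse I P Q)\<^sup>+" "(Z, Y) \<in> (glue_hasse I P Q)\<^sup>+" for Z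
  proof -
    from step_iff[OF that(2)] obtain j c b' where 2: "j \<in> I" "(c, b') \<in> P j" "c \<noteq> b'"
      "Z = cl j c" "Y = cl j b'" by blast
    have 3: "b = b'" "(c, b') \<in> P i" "Z = cl i c"
      using transfer[of j i c b' b] 1 2 by (auto simp: Field_def hasse_def)
    from step_iff[OF that(1)] obtain l a' c' where 4: "l \<in> I" "(a', c') \<in> P l" "a' \<noteq> c'"
      "X = cl l a'" "Z = cl l c'" by blast
    have 5: "c = c'" "(a', c') \<in> P i" "X = cl i a'"
      using transfer[of l i a' c' c] 1 3 4 by (auto simp: Field_def)
    then have "a' = a"
      using 1 glue_class_eq_iff[of i I i a' P a Q] by (auto simp: Field_def hasse_def)
    then show False using 1 2 3 4 5 by (auto simp: hasse_def)
  qed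
  then show "(X, Y) \<in> hasse (poset_glue I P Q)"
    using XY no_cycle by (auto simp: hasse_def poset_glue_def)
qed

end

end

theory Submission
  imports Defs
begin

text \<open>
  The vertices of a simple path are distinct, so a multipath contains at most one edge with
  target \<open>v\<close>. Hence each multipath of \<open>G\<close> lies in some \<open>P(G\<^sub>v\<^sup>(\<^sup>h\<^sup>))\<close>, and one lying in two of
  them contains no edge with target \<open>v\<close>, i.e. lies in \<open>P(G\<^sub>v\<^sup>k)\<close>. A finite poset covered by
  down-closed subposets meeting pairwise in \<open>Q\<close> is their gluing along \<open>Q\<close>, because its Hasse
  diagram is the union of theirs.
\<close>

section \<open>Finite orders and their Hasse diagrams\<close>

text \<open>Induction on the number of elements of the closed interval from \<open>a\<close> to
  \<open>b\<close>: if the pair is not a covering pair, an element strictly between splits the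
  interval into two smaller ones, whose chains are concatenated.\<close>

lemma trancl_hasse_finite:
  assumes po: "partial_order_on (Field r) r" and fin: "finite r"
    and ab: "(a, b) \<in> r" "a \<noteq> b"
  shows "(a, b) \<in> (hasse r)\<^sup>+"
proof -
  have tr: "(x, z) \<in> r" if "(x, y) \<in> r" "(y, z) \<in> r" for x y z
    using po that unfolding partial_order_on_def preorder_on_def trans_def by blast
  have anti: "x = y" if "(x, y) \<in> r" "(y, x) \<in> r" for x y
    using po that unfolding partial_order_on_def antisym_def by blast
  have rf: "(x, x) \<in> r" if "x \<in> Field r" for x
    using po that unfolding partial_order_on_def preorder_on_def refl_on_def by blast
  let ?between = "\<lambda>a b. {c. (a, c) \<in> r \<and> (c, b) \<in> r}"
  have fin_between: "finite (?between a b)" for a b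
    by (rule finite_subset[of _ "fst ` r"]) (use fin in force)+
  show ?thesis
    using ab
  proof (induction "card (?between a b)" arbitrary: a b rule: less_induct)
    case less
    show ?case
    proof (cases "(a, b) \<in> hasse r")
      case True
      then show ?thesis by blast
    next
      case False
      then obtain c where c: "c \<noteq> a" "c \<noteq> b" "(a, c) \<in> r" "(c, b) \<in> r"
        using less.prems by (auto simp: hasse_def)
      \<comment> \<open>Reflexivity puts both endpoints into the full interval; by antisymmetry the
        part up to \<open>c\<close> loses \<open>b\<close> and the part from \<open>c\<close> loses
        \<open>a\<close>.\<close>
      have "?between a c \<subset> ?between a b"
      proof
        show "?between a c \<subseteq> ?between a b" using tr c by blast
        have "b \<in> ?between a b" "b \<notin> ?between a c"
          using less.prems rf[of b] anti c by (auto simp: Field_def)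
        then show "?between a c \<noteq> ?between a b" by blast
      qed
      moreover have "?between c b \<subset> ?between a b"
      proof
        show "?between c b \<subseteq> ?between a b" using tr c by blast
        have "a \<in> ?between a b" "a \<notin> ?between c b"
          using less.prems rf[of a] anti c by (auto simp: Field_def)
        then show "?between c b \<noteq> ?between a b" by blast
      qed
      ultimately have "(a, c) \<in> (hasse r)\<^sup>+" "(c, b) \<in> (hasse r)\<^sup>+"
        using less.hyps c psubset_card_mono[OF fin_between] by simp_all
      then show ?thesis by (rule trancl_trans)
    qed
  qed
qed

text \<open>Brings a finite order into the shape in which \<open>poset_glue\<close> is defined, so
  that orders can be compared through their Hasse diagrams.\<close>

lemma finite_order_eq_trancl_hasse:
  assumes "partial_order_on (Field r) r" and "finite r"
  shows "r = Id_on (Field r) \<union> (hasse r)\<^sup>+"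
proof
  show "r \<subseteq> Id_on (Field r) \<union> (hasse r)\<^sup>+"
    using trancl_hasse_finite[OF assms] by (auto simp: Field_def Id_on_def)
  have "(hasse r)\<^sup>+ \<subseteq> r\<^sup>+"
    by (rule trancl_mono_subset) (auto simp: hasse_def)
  also have "r\<^sup>+ = r"
    using assms by (simp add: partial_order_on_def preorder_on_def trancl_id)
  finally show "Id_on (Field r) \<union> (hasse r)\<^sup>+ \<subseteq> r"
    using assms by (auto simp: partial_order_on_def preorder_on_def refl_on_def)
qed

text \<open>Chains of images lift back to chains: by injectivity, two consecutive steps that meet in
  the image already meet at a common preimage.\<close>

lemma trancl_image_inj_on:
  assumes inj: "inj_on f (Field r)"
  shows "(map_prod f f ` r)\<^sup>+ = map_prod f f ` r\<^sup>+"
proof (intro equalityI subrelI)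
  fix X Y assume "(X, Y) \<in> (map_prod f f ` r)\<^sup>+"
  then show "(X, Y) \<in> map_prod f f ` r\<^sup>+"
  proof (induction rule: trancl_induct)
    case (base Y)
    then show ?case by force
  next
    case (step Y Z)
    from step.IH obtain a b where 1: "(a, b) \<in> r\<^sup>+" "X = f a" "Y = f b" by auto
    from step.hyps obtain b' c where 2: "(b', c) \<in> r" "Y = f b'" "Z = f c" by auto
    have "b \<in> Field r" using 1 by (metis Field_def UnI2 Range.intros trancl_range)
    moreover have "b' \<in> Field r" using 2 by (auto simp: Field_def)
    ultimately have "b = b'" using inj 1 2 by (auto dest: inj_onD)
    then show ?case using 1 2 by (metis map_prod_imageI trancl.trancl_into_trancl)
  qed
next
  fix X Y assume "(X, Y) \<in> map_prod f f ` r\<^sup>+"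
  then obtain a b where ab: "(a, b) \<in> r\<^sup>+" "X = f a" "Y = f b" by auto
  from ab(1) have "(f a, f b) \<in> (map_prod f f ` r)\<^sup>+"
    by (induction rule: trancl_induct) (auto intro: trancl_into_trancl map_prod_imageI)
  with ab show "(X, Y) \<in> (map_prod f f ` r)\<^sup>+" by simp
qed

section \<open>Gluing from a down-closed cover\<close>

text \<open>Whatever lies below \<open>b\<close> in \<open>r\<close> is again in \<open>F\<close>,
  so an element separating \<open>a\<close> from \<open>b\<close> in \<open>r\<close> also separates
  them in \<open>s\<close>.\<close>

lemma hasse_down_closed:
  assumes "Restr r F = s" and "\<And>a b. (a, b) \<in> r \<Longrightarrow> b \<in> F \<Longrightarrow> a \<in> F"
  shows "hasse s = {(a, b) \<in> hasse r. b \<in> F}"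
  unfolding hasse_def assms(1)[symmetric] using assms(2) by blast

text \<open>The isomorphism sends \<open>x\<close> to the class of any of its copies. It carries the
  Hasse diagram of \<open>r\<close> onto the glued diagram, and taking transitive closures carries
  \<open>r\<close> onto \<open>poset_glue I P Q\<close>.\<close>

lemma iso_poset_glue_of_cover:
  assumes po: "partial_order_on (Field r) r" and fin: "finite r"
    and sub: "\<And>i. i \<in> I \<Longrightarrow> Restr r (Field (P i)) = P i"
    and down: "\<And>i a b. i \<in> I \<Longrightarrow> (a, b) \<in> r \<Longrightarrow> b \<in> Field (P i) \<Longrightarrow> a \<in> Field (P i)"
    and cover: "Field r = (\<Union>i\<in>I. Field (P i))"
    and meet: "\<And>i j. i \<in> I \<Longrightarrow> j \<in> I \<Longrightarrow> i \<noteq> j \<Longrightarrow> Field (P i) \<inter> Field (P j) \<subseteq> Field Q"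
  shows "\<exists>f. iso r (poset_glue I P Q) f"
proof -
  \<comment> \<open>An arbitrary member containing \<open>x\<close>; by \<open>f_eq\<close> the
    class \<open>f x\<close> does not depend on the choice.\<close>
  define idx where "idx x = (SOME i. i \<in> I \<and> x \<in> Field (P i))" for x
  define f where "f x = glue_equiv I P Q `` {(idx x, x)}" for x
  have idx: "idx x \<in> I \<and> x \<in> Field (P (idx x))" if "x \<in> Field r" for x
    unfolding idx_def by (rule someI_ex) (use that cover in blast)
  have f_eq: "glue_equiv I P Q `` {(i, x)} = f x" if "i \<in> I" "x \<in> Field (P i)" for i x
  proof -
    \<comment> \<open>If \<open>i\<close> differs from \<open>idx x\<close>, then \<open>x\<close>
      lies in two members, hence in \<open>Field Q\<close> by \<open>meet\<close>, and its two
      copies are identified.\<close>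
    have x: "x \<in> Field r" using that cover by blast
    show ?thesis
      unfolding f_def
      using glue_class_eq_iff[of i I "idx x" x P x Q] meet[of i "idx x"] idx[OF x] that by blast
  qed
  have inj: "inj_on f (Field r)"
    using idx by (intro inj_onI) (auto simp: f_def glue_class_eq_iff)
  have carrier: "glue_carrier I P Q = f ` Field r"
  proof -
    have "glue_carrier I P Q = (\<Union>i\<in>I. (\<lambda>x. glue_equiv I P Q `` {(i, x)}) ` Field (P i))"
      unfolding glue_carrier_def glue_disjoint_union_def quotient_def by blast
    also have "\<dots> = (\<Union>i\<in>I. f ` Field (P i))"
      using f_eq by (intro SUP_cong image_cong) auto
    finally show ?thesis by (simp add: cover image_UN)
  qed
  have hasse_P: "hasse (P i) = {(a, b) \<in> hasse r. b \<in> Field (P i)}" if "i \<in> I" for i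
    by (rule hasse_down_closed) (use sub down that in blast)+
  have "glue_hasse I P Q = {(f a, f b) | i a b. i \<in> I \<and> (a, b) \<in> hasse (P i)}"
  proof -
    have "a \<in> Field (P i) \<and> b \<in> Field (P i)" if "(a, b) \<in> hasse (P i)" for i a b
      using that by (auto simp: hasse_def Field_def)
    then show ?thesis unfolding glue_hasse_def using f_eq by (intro Collect_cong) metis
  qed
  also have "\<dots> = map_prod f f ` hasse r"
  proof -
    have "b \<in> (\<Union>i\<in>I. Field (P i))" if "(a, b) \<in> hasse r" for a b
    proof -
      have "b \<in> Field r" using that by (auto simp: hasse_def Field_def)
      then show ?thesis by (simp only: cover)
    qed
    \<comment> \<open>Any member that contains the upper element of a covering pair contains the
      whole pair, by \<open>hasse_P\<close>.\<close>
    then have "hasse r = (\<Union>i\<in>I. hasse (P i))"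
      using hasse_P by fastforce
    then show ?thesis by (auto simp: map_prod_def) blast?
  qed
  finally have "glue_hasse I P Q = map_prod f f ` hasse r" .
  moreover have "Field (hasse r) \<subseteq> Field r"
    by (rule mono_Field) (auto simp: hasse_def)
  ultimately have "(glue_hasse I P Q)\<^sup>+ = map_prod f f ` (hasse r)\<^sup>+"
    using inj trancl_image_inj_on by (metis inj_on_subset)
  moreover have "Id_on (glue_carrier I P Q) = map_prod f f ` Id_on (Field r)"
    unfolding carrier by force
  ultimately have glue: "poset_glue I P Q = map_prod f f ` r"
    unfolding poset_glue_def
    by (subst finite_order_eq_trancl_hasse[OF po fin]) (simp add: image_Un)
  have "Field (poset_glue I P Q) = f ` Field r"
    unfolding glue Field_def by force
  moreover have "(a, b) \<in> r \<longleftrightarrow> (f a, f b) \<in> poset_glue I P Q"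
    if "a \<in> Field r" "b \<in> Field r" for a b
  proof
    assume "(f a, f b) \<in> poset_glue I P Q"
    then obtain a' b' where "(a', b') \<in> r" "f a = f a'" "f b = f b'"
      unfolding glue by auto
    then show "(a, b) \<in> r" using inj that by (metis FieldI1 FieldI2 inj_onD)
  qed (auto simp: glue)
  ultimately have "iso r (poset_glue I P Q) f"
    using inj by (simp add: iso_iff2 bij_betw_def)
  then show ?thesis by blast
qed

section \<open>Edges of a multipath with a common target\<close>

text \<open>Among the subgraphs that contain \<open>S\<close> and satisfy \<open>P\<close>, one with
  the greatest number of vertices plus arcs is maximal. With \<open>P\<close> taken as
  \<open>connected\<close>, this yields a component around \<open>S\<close>.\<close>

lemma (in fin_digraph) max_subgraph_extends:
  assumes "subgraph S G" and "P S"
  shows "\<exists>C. max_subgraph P C \<and> subgraph S C"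
proof -
  let ?m = "\<lambda>C. card (verts C) + card (arcs C)"
  let ?Q = "\<lambda>C. subgraph S C \<and> subgraph C G \<and> P C"
  have S: "?Q S" using assms by (auto intro: wf_digraph.subgraph_refl)
  have "?m C < Suc (?m G)" if "?Q C" for C
    using that by (auto intro!: add_mono card_mono simp: less_Suc_eq_le)
  then obtain C where C: "?Q C" and max: "\<And>D. ?Q D \<Longrightarrow> ?m D \<le> ?m C"
    using ex_has_greatest_nat[of ?Q S ?m "Suc (?m G)"] S by (meson less_imp_le)
  have "D = C" if D: "subgraph C D" "subgraph D G" "P D" for D
  proof -
    have "?m D \<le> ?m C" using max C D subgraph_trans by blast
    moreover have fin: "finite (verts D)" "finite (arcs D)"
      using D by (auto intro: finite_subset[OF _ finite_verts] finite_subset[OF _ finite_arcs])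
    moreover have le: "verts C \<subseteq> verts D" "arcs C \<subseteq> arcs D" using D by auto
    \<comment> \<open>The sum for \<open>D\<close> is at most that for \<open>C\<close>, while each
      summand for \<open>D\<close> is at least that for \<open>C\<close>; hence both summands
      agree.\<close>
    ultimately have "card (verts D) \<le> card (verts C)" "card (arcs D) \<le> card (arcs C)"
      using card_mono[OF fin(1) le(1)] card_mono[OF fin(2) le(2)] by linarith+
    then have "verts C = verts D" "arcs C = arcs D"
      by (simp_all only: card_seteq[OF fin(1) le(1)] card_seteq[OF fin(2) le(2)])
    then show ?thesis
      using D by (auto simp: subgraph_def compatible_def intro: pre_digraph.equality)
  qed
  then show ?thesis using C by (auto simp: max_subgraph_def)
qed

text \<open>After symmetrization every vertex reaches \<open>v\<close> and is reached from it, so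
  any two vertices are joined through \<open>v\<close>.\<close>

lemma connected_two_in_arcs:
  "connected (with_proj \<lparr>pverts = {a, b, v}, parcs = {(a, v), (b, v)}\<rparr>)"
proof -
  let ?S = "with_proj \<lparr>pverts = {a, b, v}, parcs = {(a, v), (b, v)}\<rparr>"
  interpret S: wf_digraph ?S by unfold_locales auto
  interpret M: pair_wf_digraph "mk_symmetric ?S"
    by unfold_locales (auto simp: mk_symmetric_def)
  have E: "parcs (mk_symmetric ?S) = {(a, v), (v, a), (b, v), (v, b)}"
    by (auto simp: mk_symmetric_def)
  have arc: "x \<rightarrow>\<^sup>*\<^bsub>mk_symmetric ?S\<^esub> y" if "(x, y) \<in> parcs (mk_symmetric ?S)" for x y
    using that by (intro M.reachable_adjI) simp
  have "v \<rightarrow>\<^sup>*\<^bsub>mk_symmetric ?S\<^esub> v"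
    by (rule M.reachable_refl) (simp add: mk_symmetric_def)
  with arc E have *: "u \<rightarrow>\<^sup>*\<^bsub>mk_symmetric ?S\<^esub> v" "v \<rightarrow>\<^sup>*\<^bsub>mk_symmetric ?S\<^esub> u"
    if "u \<in> {a, b, v}" for u
    using that by blast+
  show ?thesis
    by (rule S.connectedI) (auto intro: M.reachable_trans[OF *])
qed

text \<open>The vertex list of a nonempty walk is its start followed by the heads of its arcs, so
  distinct vertices force distinct heads.\<close>

lemma simple_path_head_inj:
  assumes "simple_path G p"
  shows "inj_on (head G) (set p)"
proof -
  obtain u w where "p \<noteq> []" "pre_digraph.cas G u p w" "distinct (pre_digraph.awalk_verts G u p)"
    using assms by (auto simp: simple_path_def pre_digraph.apath_def pre_digraph.awalk_def)
  then have "distinct (map (head G) p)"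
    by (simp add: pre_digraph.awalk_verts_conv')
  then show ?thesis by (simp add: distinct_map)
qed

lemma multipath_subgraph:
  assumes "multipath G H"
  shows "pverts H = pverts G" "parcs H \<subseteq> parcs G" "wf_digraph (with_proj H)"
  using assms unfolding multipath_def spanning_def subgraph_def by (simp_all only:) simp_all

text \<open>Two edges into \<open>v\<close> span a connected subgraph and thus lie in one component.
  That component is a simple path, where heads are distinct.\<close>

lemma multipath_in_arc_unique:
  assumes fin: "pair_fin_digraph G" and mp: "multipath G H"
    and av: "(a, v) \<in> parcs H" and bv: "(b, v) \<in> parcs H"
  shows "a = b"
proof -
  let ?S = "with_proj \<lparr>pverts = {a, b, v}, parcs = {(a, v), (b, v)}\<rparr>"
  note H = multipath_subgraph[OF mp]
  interpret fin_digraph H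
    using H fin pair_fin_digraph.pair_finite_verts[OF fin] pair_fin_digraph.pair_finite_arcs[OF fin]
    by (intro wf_digraph.fin_digraphI) (auto intro: finite_subset)
  have "subgraph ?S H"
  proof (rule subgraphI)
    show "wf_digraph ?S" by unfold_locales auto
    show "verts ?S \<subseteq> verts H"
      using wellformed[of "(a, v)"] wellformed[of "(b, v)"] av bv by auto
  qed (use av bv H in \<open>auto simp: compatible_def\<close>)
  then obtain C where C: "connected_component H C" "subgraph ?S C"
    using max_subgraph_extends connected_two_in_arcs[of a b v]
    unfolding connected_component_def by blast
  \<comment> \<open>\<open>C\<close> is a general \<open>pre_digraph\<close>; that its
    \<open>head\<close> is \<open>snd\<close> comes from compatibility with
    \<open>?S\<close>.\<close>
  have arcs: "(a, v) \<in> arcs C" "(b, v) \<in> arcs C" and head: "head C = snd"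
    using C(2) by (auto simp: compatible_def)
  then obtain p where "simple_path C p" "set p = arcs C"
    using mp C(1) unfolding multipath_def by blast
  then have "inj_on snd (arcs C)"
    using simple_path_head_inj head by metis
  then show ?thesis
    using arcs inj_onD[of snd "arcs C" "(a, v)" "(b, v)"] by simp
qed

text \<open>A multipath has all vertices of \<open>G\<close>, so it is determined by its edge set, a
  subset of the finite set \<open>parcs G\<close>.\<close>

lemma finite_path_poset:
  assumes "pair_fin_digraph G"
  shows "finite (path_poset G)"
proof -
  have "{H. multipath G H} \<subseteq> (\<lambda>A. \<lparr>pverts = pverts G, parcs = A\<rparr>) ` Pow (parcs G)"
    using multipath_subgraph
    by (intro subsetI image_eqI[of _ _ "parcs _"] pair_pre_digraph.equality) simp_all
  then have "finite {H. multipath G H}"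
    using pair_fin_digraph.pair_finite_arcs[OF assms] by (auto intro: finite_subset)
  moreover have "path_poset G \<subseteq> {H. multipath G H} \<times> {H. multipath G H}"
    by (auto simp: path_poset_def)
  ultimately show ?thesis by (auto intro: finite_subset)
qed

section \<open>The cover of the path poset by the edges into \<open>v\<close>\<close>

theorem theorem3p13:
  fixes G :: "'a pair_pre_digraph" and v :: 'a
    and k :: nat and e :: "nat \<Rightarrow> 'a \<times> 'a"
  assumes "pair_digraph G"
    and "v \<in> pverts G"
    and "k \<ge> 2"
    and "bij_betw e {1..k} (in_arcs (with_proj G) v)"
  shows "\<exists>f. iso (path_poset G)
           (poset_glue {1..k}
              (\<lambda>h. path_poset (add_edge (del_edges G (e ` {1..k})) (e h)))
              (path_poset (del_edges G (e ` {1..k})))) f"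
proof (rule iso_poset_glue_of_cover)
  interpret pair_digraph G by fact
  let ?D = "del_edges G (e ` {1..k})"
  let ?A = "\<lambda>h. add_edge ?D (e h)"
  have E: "e ` {1..k} = {a \<in> parcs G. snd a = v}"
    using assms(4) by (auto simp: bij_betw_def in_arcs_def)
  have inj: "inj_on e {1..k}" using assms(4) by (simp add: bij_betw_def)
  have parcs_D: "parcs ?D = {a \<in> parcs G. snd a \<noteq> v}" "pverts ?D = pverts G"
    unfolding del_edges_def E by auto
  have parcs_A: "parcs (?A h) = insert (e h) {a \<in> parcs G. snd a \<noteq> v}"
    "pverts (?A h) = pverts G" if "h \<in> {1..k}" for h
  proof -
    have "e h \<in> parcs G" using E that by blast
    \<comment> \<open>\<open>add_edge\<close> also inserts the endpoints of the edge; here they are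
      vertices already.\<close>
    then have "insert (fst (e h)) (insert (snd (e h)) (pverts G)) = pverts G"
      using arc_fst_in_verts arc_snd_in_verts by blast
    then show "parcs (?A h) = insert (e h) {a \<in> parcs G. snd a \<noteq> v}"
      "pverts (?A h) = pverts G"
      using parcs_D by (simp_all add: add_edge_def)
  qed
  have span: "spanning (with_proj G') (with_proj G)"
    if "pverts G' = pverts G" "parcs G' \<subseteq> parcs G" for G'
  proof -
    have "wf_digraph (with_proj G')"
      by unfold_locales (use that arc_fst_in_verts arc_snd_in_verts in \<open>simp_all add: subsetD\<close>)
    then show ?thesis
      using that wf_digraph_axioms by (simp add: spanning_def subgraph_def compatible_def)
  qed
  have span_D: "spanning (with_proj ?D) (with_proj G)"
    by (rule span) (simp_all only: parcs_D, blast)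
  have span_A: "spanning (with_proj (?A h)) (with_proj G)" if "h \<in> {1..k}" for h
    by (rule span) (use parcs_A[OF that] E that in auto)
  show "partial_order_on (Field (path_poset G)) (path_poset G)"
    by (simp only: Field_path_poset partial_order_on_path_poset)
  show "finite (path_poset G)"
    by (rule finite_path_poset) unfold_locales
  show "Restr (path_poset G) (Field (path_poset (?A h))) = path_poset (?A h)"
    if "h \<in> {1..k}" for h
    using path_poset_spanning_subgraph(1)[OF span_A[OF that]] .
  show "H \<in> Field (path_poset (?A h))"
    if "h \<in> {1..k}" "(H, H') \<in> path_poset G" "H' \<in> Field (path_poset (?A h))" for h H H'
    using path_poset_spanning_subgraph(2)[OF span_A] that by blast
  \<comment> \<open>Membership becomes a bound on the edge set of a multipath of \<open>G\<close>,
    which makes the meet and cover conditions set-theoretic.\<close>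
  have Field_A: "Field (path_poset (?A h)) =
      {H. multipath G H \<and> parcs H \<subseteq> insert (e h) {a \<in> parcs G. snd a \<noteq> v}}"
    if "h \<in> {1..k}" for h
    by (simp only: Field_path_poset multipath_spanning_subgraph[OF span_A[OF that]]
        parcs_A[OF that])
  have Field_D: "Field (path_poset ?D) =
      {H. multipath G H \<and> parcs H \<subseteq> {a \<in> parcs G. snd a \<noteq> v}}"
    by (simp only: Field_path_poset multipath_spanning_subgraph[OF span_D] parcs_D)
  show "Field (path_poset (?A i)) \<inter> Field (path_poset (?A j)) \<subseteq> Field (path_poset ?D)"
    if "i \<in> {1..k}" "j \<in> {1..k}" "i \<noteq> j" for i j
  proof -
    have "e i \<noteq> e j" using inj that by (auto dest: inj_onD)
    then show ?thesis unfolding Field_A[OF that(1)] Field_A[OF that(2)] Field_D by blast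
  qed
  have "\<exists>h\<in>{1..k}. H \<in> Field (path_poset (?A h))" if H: "multipath G H" for H
  proof -
    have sub: "parcs H \<subseteq> parcs G"
      by (rule multipath_subgraph(2)[OF H])
    show ?thesis
    proof (cases "\<exists>a. (a, v) \<in> parcs H")
      case True
      then obtain a where a: "(a, v) \<in> parcs H" ..
      then obtain h where h: "h \<in> {1..k}" "e h = (a, v)"
      proof -
        have "(a, v) \<in> e ` {1..k}" unfolding E using sub a by auto
        then show thesis using that by (elim imageE) simp
      qed
      \<comment> \<open>Since \<open>(a, v)\<close> is the only edge of \<open>H\<close> into
        \<open>v\<close>, all other edges survive the deletion.\<close>
      have "parcs H \<subseteq> insert (e h) {a \<in> parcs G. snd a \<noteq> v}"
        using sub h multipath_in_arc_unique[OF pair_fin_digraph_axioms H a] by auto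
      then show ?thesis using H h Field_A by blast
    next
      case False
      \<comment> \<open>With no edge into \<open>v\<close>, the multipath lies in every member of
        the cover; \<open>1\<close> is a valid index because \<open>k \<ge> 2\<close>.\<close>
      then have "parcs H \<subseteq> insert (e 1) {a \<in> parcs G. snd a \<noteq> v}" using sub by auto
      then show ?thesis using H Field_A[of 1] assms(3) by (auto intro: bexI[of _ 1])
    qed
  qed
  then show "Field (path_poset G) = (\<Union>h\<in>{1..k}. Field (path_poset (?A h)))"
    unfolding Field_path_poset[of G] using Field_A by blast
qed

end
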